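(* Let $\mathbb{M}$ be a weight sequence. The following are equivalent: (i) $\gamma(\mathbb{M})>0$, $\check{\mathbb{M}}$ satisfies (nq), and $\mathbb{M}$ satisfies Langenbruch's condition. (ii) $\gamma(\mathbb{M})>1$. (Here $\check{\mathbb{M}}$ denotes the sequence $(M_p/p!)_{p\in\mathbb{N}_0}$.)
   Context: A weight sequence is a sequence $\mathbb{M}=(M_p)_{p\in\mathbb{N}_0}$ of positive real numbers with $M_0=1$, logarithmically convex ($M_p^2\le M_{p-1}M_{p+1}$, $p\ge1$), and such that $m_p:=M_{p+1}/M_p\to\infty$. Index: $(c_p)_p$ is almost increasing if there is $a>0$ with $c_p\le a\,c_q$ for all $q\ge p$. $\gamma(\mathbb{M}):=\sup\{\gamma>0:(m_p/(p+1)^\gamma)_{p\in\mathbb{N}_0}\text{ is almost increasing}\}\in[0,\infty]$ ($\sup\emptyset=0$). A sequence $(N_p)$ satisfies (nq) if $\sum_{p=0}^\infty\frac{N_p}{(p+1)N_{p+1}}<\infty$. For $N_p=M_p/p!$ this means $\sum_{p=0}^\infty 1/m_p<\infty$. $\omega_{\mathbb{M}}(t):=\sup_{p\in\mathbb{N}_0}\ln(t^p/M_p)$ for $t>0$, $\omega_{\mathbb{M}}(0)=0$. When $(M_p/p!)_p$ satisfies (nq), $\int_1^\infty\omega_{\mathbb{M}}(t)t^{-2}dt<\infty$, so the harmonic extension is well defined: $P_{\omega_{\mathbb{M}}}(x+iy)=\frac{|y|}{\pi}\int_{-\infty}^\infty\frac{\omega_{\mathbb{M}}(|t|)}{(t-x)^2+y^2}dt$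 for $x\in\mathbb{R}$, $y\ne0$, and $P_{\omega_{\mathbb{M}}}(x)=\omega_{\mathbb{M}}(|x|)$ for $x\in\mathbb{R}$. Langenbruch's condition (for $\mathbb{M}$ such that $(M_p/p!)_p$ satisfies (nq)): there exists $C>0$ such that $P_{\omega_{\mathbb{M}}}(iy)\le\omega_{\mathbb{M}}(Cy)+C$ for all $y\ge0$. *)

theory Defs
  imports "HOL-Analysis.Analysis"
begin

definition quot_seq :: "(nat \<Rightarrow> real) \<Rightarrow> nat \<Rightarrow> real" where
  "quot_seq M p = M (p + 1) / M p"

definition weight_sequence :: "(nat \<Rightarrow> real) \<Rightarrow> bool" where
  "weight_sequence M \<longleftrightarrow>
     (\<forall>p. M p > 0) \<and> M 0 = 1 \<and>
     (\<forall>p\<ge>1. (M p)\<^sup>2 \<le> M (p - 1) * M (p + 1)) \<and>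
     filterlim (quot_seq M) at_top sequentially"

definition almost_increasing :: "(nat \<Rightarrow> real) \<Rightarrow> bool" where
  "almost_increasing c \<longleftrightarrow> (\<exists>a>0. \<forall>p q. p \<le> q \<longrightarrow> c p \<le> a * c q)"

text \<open>The supremum is taken in \<^typ>\<open>ennreal\<close>, so it may be infinite, and the supremum
  of the empty set is \<open>0\<close>.\<close>

definition gamma_index :: "(nat \<Rightarrow> real) \<Rightarrow> ennreal" where
  "gamma_index M =
     Sup (ennreal ` {\<gamma>. \<gamma> > 0 \<and>
       almost_increasing (\<lambda>p. quot_seq M p / real (p + 1) powr \<gamma>)})"

definition check_seq :: "(nat \<Rightarrow> real) \<Rightarrow> nat \<Rightarrow> real" where
  "check_seq M p = M p / fact p"

text \<open>The series condition (nq), meant for sequences of positive numbers.\<close>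

definition nq :: "(nat \<Rightarrow> real) \<Rightarrow> bool" where
  "nq N \<longleftrightarrow> summable (\<lambda>p. N p / (real (p + 1) * N (p + 1)))"

text \<open>For a weight sequence the set under the supremum is bounded above, because
  \<^term>\<open>quot_seq M\<close> tends to infinity. So the real supremum is the genuine one.\<close>

definition omega :: "(nat \<Rightarrow> real) \<Rightarrow> real \<Rightarrow> real" where
  "omega M t = (if t > 0 then (SUP p. ln (t ^ p / M p)) else 0)"

text \<open>The Poisson integral converges if \<^term>\<open>check_seq M\<close> satisfies \<^const>\<open>nq\<close>. Otherwise the
  Bochner integral is \<open>0\<close> by convention and the definitions below carry no meaning, so they
  should be used only together with \<^term>\<open>nq (check_seq M)\<close>.\<close>

definition harmonic_extension :: "(nat \<Rightarrow> real) \<Rightarrow> complex \<Rightarrow> real" where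
  "harmonic_extension M z =
     (if Im z = 0 then omega M \<bar>Re z\<bar>
      else \<bar>Im z\<bar> / pi * (LINT t|lborel. omega M \<bar>t\<bar> / ((t - Re z)\<^sup>2 + (Im z)\<^sup>2)))"

definition langenbruch :: "(nat \<Rightarrow> real) \<Rightarrow> bool" where
  "langenbruch M \<longleftrightarrow>
     (\<exists>C>0. \<forall>y\<ge>0. harmonic_extension M (\<i> * of_real y) \<le> omega M (C * y) + C)"

end

theory Submission
  imports Defs "HOL-Real_Asymp.Real_Asymp"
begin

text \<open>Write \<open>m\<^sub>p = M\<^sub>p\<^sub>+\<^sub>1 / M\<^sub>p\<close>. Log-convexity gives \<open>\<omega>(t) = \<Sum>\<^sub>q ln\<^sup>+ (t / m\<^sub>q)\<close>, so the Poisson integral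
  \<open>P(iy)\<close> is the sum of the Poisson integrals of the single terms. Such a term differs from
  \<open>ln (y / m\<^sub>q)\<close> by a bounded amount if \<open>m\<^sub>q \<le> y\<close>, and is comparable to \<open>y / m\<^sub>q\<close> if \<open>m\<^sub>q \<ge> y\<close>.
  Hence, up to a multiple of the number of \<open>m\<^sub>q \<le> y\<close>, the excess of \<open>P(iy)\<close> over \<open>\<omega>(y)\<close> is
  \<open>y\<close> times the sum of \<open>1 / m\<^sub>q\<close> over \<open>m\<^sub>q > y\<close>, and Langenbruch's condition amounts to condition
  \<open>(\<gamma>\<^sub>1)\<close>: \<open>\<Sum>\<^sub>q\<^sub>\<ge>\<^sub>p 1 / m\<^sub>q \<le> A (p + 1) / m\<^sub>p\<close>. The hypothesis \<open>\<gamma>(M) > 0\<close> is what bounds the number of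
  \<open>m\<^sub>q \<le> C m\<^sub>p\<close> by a multiple of \<open>p + 1\<close>. Finally \<open>(\<gamma>\<^sub>1)\<close> is equivalent to \<open>\<gamma>(M) > 1\<close>, because it is a
  discrete differential inequality forcing the tails to decay like a negative power of \<open>p + 1\<close>.\<close>

section \<open>Positive part of the logarithm and explicit integrals\<close>

definition ln_plus :: "real \<Rightarrow> real" where
  "ln_plus x = max 0 (ln x)"

lemma ln_plus_nonneg: "0 \<le> ln_plus x"
  by (simp add: ln_plus_def)

lemma ln_plus_eq_0: "0 \<le> x \<Longrightarrow> x \<le> 1 \<Longrightarrow> ln_plus x = 0"
  by (cases "x = 0") (auto simp: ln_plus_def max_def)

lemma ln_plus_eq_ln: "1 \<le> x \<Longrightarrow> ln_plus x = ln x"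
  by (auto simp: ln_plus_def)

lemma ln_le_ln_plus: "ln x \<le> ln_plus x"
  by (auto simp: ln_plus_def)

lemma ln_plus_mult_le:
  assumes "0 \<le> x" "0 < y"
  shows "ln_plus (x * y) \<le> ln_plus x + ln_plus y"
proof (cases "x = 0")
  case False
  then show ?thesis using assms by (auto simp: ln_plus_def ln_mult)
qed (simp add: ln_plus_def)

lemma borel_measurable_ln_plus [measurable]: "ln_plus \<in> borel_measurable borel"
  unfolding ln_plus_def by measurable

text \<open>On \<open>{m..}\<close> the antiderivative is elementary: it equals -1/m at m and
  vanishes at infinity. Below m the logarithm contributes nothing, and evenness doubles the
  value.\<close>

lemma has_bochner_integral_ln_plus_inverse_square:
  fixes m :: real
  assumes "0 < m"
  shows "has_bochner_integral lborel (\<lambda>t. ln_plus (\<bar>t\<bar> / m) / t\<^sup>2) (2 / m)"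
proof -
  let ?f = "\<lambda>t. ln_plus (\<bar>t\<bar> / m) / t\<^sup>2" and ?F = "\<lambda>t. - (ln (t / m) + 1) / t"
  have "(\<integral>\<^sup>+t. ennreal (?f t) * indicator {m..} t \<partial>lborel) = 0 - ?F m"
  proof (rule nn_integral_FTC_atLeast[where F = ?F])
    show "(?F has_real_derivative ?f t) (at t)" if "m \<le> t" for t
      using that assms
      by (auto intro!: derivative_eq_intros simp: ln_plus_eq_ln power2_eq_square field_simps)
    show "0 \<le> ?f t" for t
      by (simp add: ln_plus_nonneg)
    show "(?F \<longlongrightarrow> 0) at_top"
      using assms by real_asymp
  qed measurable
  moreover have "(\<integral>\<^sup>+t. ennreal (?f t) * indicator {m..} t \<partial>lborel) =
      (\<integral>\<^sup>+t. ennreal (indicator {0..} t *\<^sub>R ?f t) \<partial>lborel)"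
    using assms by (intro nn_integral_cong) (auto simp: indicator_def ln_plus_eq_0)
  ultimately have "has_bochner_integral lborel (\<lambda>t. indicator {0..} t *\<^sub>R ?f t) (1 / m)"
    using assms by (intro has_bochner_integral_nn_integral) (auto simp: ln_plus_nonneg)
  from has_bochner_integral_even_function[OF this] show ?thesis
    by simp
qed

text \<open>Measures the loss in \<open>log_potential_ge_ln\<close>. The integrand is unbounded near
  0, so the antiderivative is used on the open interval from 0 to y, through its one-sided limits 0
  and y.\<close>

lemma has_bochner_integral_ln_plus_inverse:
  fixes y :: real
  assumes "0 < y"
  shows "has_bochner_integral lborel (\<lambda>t. ln_plus (y / \<bar>t\<bar>)) (2 * y)"
proof -
  let ?f = "\<lambda>t. ln_plus (y / \<bar>t\<bar>)" and ?F = "\<lambda>t. t * ln (y / t) + t"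
  let ?g = "\<lambda>t. ln (y / t)"
  have F: "(?F \<longlongrightarrow> 0) (at_right 0)" "(?F \<longlongrightarrow> y) (at_left y)"
    using assms by real_asymp+
  have FTC: "set_integrable lborel (einterval 0 (ereal y)) ?g"
      "(LBINT t=0..ereal y. ?g t) = y - 0"
  proof -
    have "(?F has_real_derivative ?g t) (at t)" "isCont ?g t" if "0 < t" for t
      using that assms by (auto intro!: derivative_eq_intros continuous_intros simp: field_simps)
    then show "set_integrable lborel (einterval 0 (ereal y)) ?g" "(LBINT t=0..ereal y. ?g t) = y - 0"
      using assms F interval_integral_FTC_nonneg[of 0 "ereal y" ?F ?g 0 y]
      by (auto simp: ereal_tendsto_simps zero_ereal_def)
  qed
  have "has_bochner_integral lborel (\<lambda>t. indicator {0<..<y} t *\<^sub>R ?g t) y"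
    using FTC assms
    by (simp add: has_bochner_integral_iff set_integrable_def interval_lebesgue_integral_def
        set_lebesgue_integral_def einterval_eq zero_ereal_def)
  \<comment> \<open>The two integrands agree pointwise: \<open>ln_plus (y / \<bar>t\<bar>)\<close>
    is 0 for t \<ge> y, and also at t = 0 because division by zero gives 0.\<close>
  then have "has_bochner_integral lborel (\<lambda>t. indicator {0..} t *\<^sub>R ?f t) y"
    by (rule has_bochner_integral_cong[THEN iffD1, rotated -1])
      (use assms in \<open>auto simp: indicator_def ln_plus_eq_0 ln_plus_eq_ln ln_plus_def\<close>)
  from has_bochner_integral_even_function[OF this] show ?thesis
    by simp
qed

text \<open>Normalises the Poisson kernel: after multiplication by y / pi its total mass is 1, so
  constants are reproduced.\<close>

lemma has_bochner_integral_inverse_sum_squares: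
  fixes y :: real
  assumes "0 < y"
  shows "has_bochner_integral lborel (\<lambda>t. 1 / (t\<^sup>2 + y\<^sup>2)) (pi / y)"
proof -
  let ?f = "\<lambda>t::real. 1 / (t\<^sup>2 + y\<^sup>2)" and ?F = "\<lambda>t. arctan (t / y) / y"
  have "(\<integral>\<^sup>+t. ennreal (?f t) * indicator {0..} t \<partial>lborel) = pi / (2 * y) - ?F 0"
  proof (rule nn_integral_FTC_atLeast[where F = ?F])
    show "(?F has_real_derivative ?f t) (at t)" for t
    proof -
      have eq: "(1 + (t / y)\<^sup>2) * (y * y) = t\<^sup>2 + y\<^sup>2"
        using assms by (simp add: power2_eq_square field_simps)
      have "inverse (1 + (t / y)\<^sup>2) * (1 / y) / y = 1 / ((1 + (t / y)\<^sup>2) * (y * y))"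
        by (simp add: divide_inverse mult.assoc)
      then have "inverse (1 + (t / y)\<^sup>2) * (1 / y) / y = ?f t"
        by (simp only: eq)
      moreover have "(?F has_real_derivative inverse (1 + (t / y)\<^sup>2) * (1 / y) / y) (at t)"
        by (intro DERIV_cdivide DERIV_chain2[OF DERIV_arctan] DERIV_ident)
      ultimately show ?thesis by (rule DERIV_cong[rotated])
    qed
    have "(?F \<longlongrightarrow> pi * inverse y / 2) at_top"
      using assms by real_asymp
    moreover have "pi * inverse y / 2 = pi / (2 * y)"
      using assms by (simp add: field_simps)
    ultimately show "(?F \<longlongrightarrow> pi / (2 * y)) at_top"
      by (simp only:)
    qed auto
  moreover have "(\<integral>\<^sup>+t. ennreal (?f t) * indicator {0..} t \<partial>lborel) =
      (\<integral>\<^sup>+t. ennreal (indicator {0..} t *\<^sub>R ?f t) \<partial>lborel)"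
    by (intro nn_integral_cong) (auto simp: indicator_def)
  ultimately have "has_bochner_integral lborel (\<lambda>t. indicator {0..} t *\<^sub>R ?f t) (pi / (2 * y))"
    using assms by (intro has_bochner_integral_nn_integral) auto
  from has_bochner_integral_even_function[OF this] show ?thesis
    by simp
qed

section \<open>Poisson integral at iy of a single logarithmic term\<close>

definition log_potential :: "real \<Rightarrow> real \<Rightarrow> real" where
  "log_potential y m = y / pi * (LINT t|lborel. ln_plus (\<bar>t\<bar> / m) / (t\<^sup>2 + y\<^sup>2))"

lemma integrable_ln_plus_kernel:
  assumes "0 < m"
  shows "integrable lborel (\<lambda>t. ln_plus (\<bar>t\<bar> / m) / (t\<^sup>2 + y\<^sup>2))"
proof (rule Bochner_Integration.integrable_bound)
  show "integrable lborel (\<lambda>t. ln_plus (\<bar>t\<bar> / m) / t\<^sup>2)"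
    using has_bochner_integral_ln_plus_inverse_square[OF assms] by (simp add: has_bochner_integral_iff)
  have "ln_plus (\<bar>t\<bar> / m) / (t\<^sup>2 + y\<^sup>2) \<le> ln_plus (\<bar>t\<bar> / m) / t\<^sup>2" for t
    by (cases "t = 0") (auto intro!: divide_left_mono simp: ln_plus_nonneg ln_plus_eq_0 add_pos_nonneg)
  then show "AE t in lborel. norm (ln_plus (\<bar>t\<bar> / m) / (t\<^sup>2 + y\<^sup>2)) \<le> norm (ln_plus (\<bar>t\<bar> / m) / t\<^sup>2)"
    by (simp add: ln_plus_nonneg)
qed measurable

lemma log_potential_le:
  assumes "0 < m" "0 < y"
  shows "log_potential y m \<le> 2 * y / (pi * m)"
proof -
  have "(LINT t|lborel. ln_plus (\<bar>t\<bar> / m) / (t\<^sup>2 + y\<^sup>2)) \<le> (LINT t|lborel. ln_plus (\<bar>t\<bar> / m) / t\<^sup>2)"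
  proof (rule integral_mono')
    show "integrable lborel (\<lambda>t. ln_plus (\<bar>t\<bar> / m) / t\<^sup>2)"
      using has_bochner_integral_ln_plus_inverse_square[OF assms(1)] by (simp add: has_bochner_integral_iff)
    show "ln_plus (\<bar>t\<bar> / m) / (t\<^sup>2 + y\<^sup>2) \<le> ln_plus (\<bar>t\<bar> / m) / t\<^sup>2" for t
      by (cases "t = 0") (auto intro!: divide_left_mono simp: ln_plus_nonneg ln_plus_eq_0 add_pos_nonneg)
  qed (simp add: ln_plus_nonneg)
  also have "\<dots> = 2 / m"
    using has_bochner_integral_ln_plus_inverse_square[OF assms(1)] by (simp add: has_bochner_integral_iff)
  finally have "log_potential y m \<le> y / pi * (2 / m)"
    unfolding log_potential_def using assms by (intro mult_left_mono) auto
  then show ?thesis by (simp add: mult.commute)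
qed

text \<open>The integrand lives on |t| > m \<ge> y, where t^2 + y^2 \<le> 2 t^2. Replacing the
  kernel by 1 / t^2 therefore costs at most a factor 2.\<close>

lemma log_potential_ge_divide:
  assumes "0 < y" "y \<le> m"
  shows "y / (pi * m) \<le> log_potential y m"
proof -
  have m: "0 < m" using assms by simp
  have "has_bochner_integral lborel (\<lambda>t. ln_plus (\<bar>t\<bar> / m) / t\<^sup>2 / 2) (2 / m / 2)"
    by (intro has_bochner_integral_divide has_bochner_integral_ln_plus_inverse_square m)
  then have "1 / m = (LINT t|lborel. ln_plus (\<bar>t\<bar> / m) / t\<^sup>2 / 2)"
    unfolding has_bochner_integral_iff by simp
  also have "\<dots> \<le> (LINT t|lborel. ln_plus (\<bar>t\<bar> / m) / (t\<^sup>2 + y\<^sup>2))"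
  proof (rule integral_mono'[OF integrable_ln_plus_kernel[OF m]])
    show "ln_plus (\<bar>t\<bar> / m) / t\<^sup>2 / 2 \<le> ln_plus (\<bar>t\<bar> / m) / (t\<^sup>2 + y\<^sup>2)" for t
    proof (cases "\<bar>t\<bar> \<le> m")
      case True
      then show ?thesis using m by (simp add: ln_plus_eq_0)
    next
      case False
      then have "y\<^sup>2 \<le> \<bar>t\<bar>\<^sup>2" using assms by (intro power_mono) auto
      then have "t\<^sup>2 + y\<^sup>2 \<le> t\<^sup>2 * 2" by simp
      moreover have "0 < t\<^sup>2 + y\<^sup>2" using assms by (simp add: add_nonneg_pos)
      ultimately have "ln_plus (\<bar>t\<bar> / m) / (t\<^sup>2 * 2) \<le> ln_plus (\<bar>t\<bar> / m) / (t\<^sup>2 + y\<^sup>2)"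
        by (intro divide_left_mono) (auto simp: ln_plus_nonneg intro!: mult_pos_pos)
      then show ?thesis by simp
    qed
  qed (simp add: ln_plus_nonneg)
  finally have "y / pi * (1 / m) \<le> log_potential y m"
    unfolding log_potential_def using assms by (intro mult_left_mono) auto
  then show ?thesis by simp
qed

text \<open>Split |t| / m as (y / m) (|t| / y) and use subadditivity of \<open>ln_plus\<close>. The
  first factor gives a constant, which the Poisson kernel reproduces; the second gives
  \<open>log_potential y y\<close>, at most 2 / pi.\<close>

lemma log_potential_le_ln_plus:
  assumes "0 < m" "0 < y"
  shows "log_potential y m \<le> ln_plus (y / m) + 2 / pi"
proof -
  let ?k = "\<lambda>t::real. t\<^sup>2 + y\<^sup>2"
  have k: "has_bochner_integral lborel (\<lambda>t. ln_plus (y / m) * (1 / ?k t)) (ln_plus (y / m) * (pi / y))"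
    by (intro has_bochner_integral_mult_right has_bochner_integral_inverse_sum_squares assms)
  have "(LINT t|lborel. ln_plus (\<bar>t\<bar> / m) / ?k t)
      \<le> (LINT t|lborel. ln_plus (y / m) * (1 / ?k t) + ln_plus (\<bar>t\<bar> / y) / ?k t)"
  proof (rule integral_mono')
    show "integrable lborel (\<lambda>t. ln_plus (y / m) * (1 / ?k t) + ln_plus (\<bar>t\<bar> / y) / ?k t)"
      using k integrable_ln_plus_kernel[OF assms(2)]
      by (intro Bochner_Integration.integrable_add) (simp_all add: has_bochner_integral_iff)
    have "ln_plus (\<bar>t\<bar> / m) \<le> ln_plus (y / m) + ln_plus (\<bar>t\<bar> / y)" for t
      using ln_plus_mult_le[of "\<bar>t\<bar> / y" "y / m"] assms by simp
    then show "ln_plus (\<bar>t\<bar> / m) / ?k t \<le> ln_plus (y / m) * (1 / ?k t) + ln_plus (\<bar>t\<bar> / y) / ?k t" for t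
      by (simp add: add_divide_distrib[symmetric] divide_right_mono)
  qed (simp add: ln_plus_nonneg)
  also have "\<dots> = ln_plus (y / m) * (pi / y) + (LINT t|lborel. ln_plus (\<bar>t\<bar> / y) / ?k t)"
    using k integrable_ln_plus_kernel[OF assms(2)]
    by (subst Bochner_Integration.integral_add) (simp_all add: has_bochner_integral_iff)
  finally have "log_potential y m \<le> y / pi * \<dots>"
    unfolding log_potential_def using assms by (intro mult_left_mono) auto
  also have "\<dots> = ln_plus (y / m) + log_potential y y"
    using assms by (simp add: log_potential_def field_simps)
  also have "log_potential y y \<le> 2 / pi"
    using log_potential_le[of y y] assms by simp
  finally show ?thesis by simp
qed

text \<open>Subadditivity in the other direction: ln (y / m) is at most the integrand's logarithm
  plus \<open>ln_plus (y / \<bar>t\<bar>)\<close>. For the latter the kernel is bounded by 1 / y^2,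
  and the integral 2 y turns into the loss 2 / pi.\<close>

lemma log_potential_ge_ln:
  assumes "0 < m" "0 < y"
  shows "ln (y / m) - 2 / pi \<le> log_potential y m"
proof -
  let ?k = "\<lambda>t::real. t\<^sup>2 + y\<^sup>2"
  have k: "has_bochner_integral lborel (\<lambda>t. ln (y / m) * (1 / ?k t) - ln_plus (y / \<bar>t\<bar>) / y\<^sup>2)
      (ln (y / m) * (pi / y) - 2 * y / y\<^sup>2)"
    by (intro has_bochner_integral_diff has_bochner_integral_mult_right
        has_bochner_integral_inverse_sum_squares has_bochner_integral_divide
        has_bochner_integral_ln_plus_inverse assms)
  have "ln (y / m) * (pi / y) - 2 * y / y\<^sup>2
      = (LINT t|lborel. ln (y / m) * (1 / ?k t) - ln_plus (y / \<bar>t\<bar>) / y\<^sup>2)"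
    using k by (simp add: has_bochner_integral_iff)
  also have "\<dots> \<le> (LINT t|lborel. ln_plus (\<bar>t\<bar> / m) / ?k t)"
  \<comment> \<open>The comparison holds only almost everywhere: at t = 0 the quotient
    \<open>y / \<bar>t\<bar>\<close> is 0, and the inequality fails there if y > m.\<close>
  proof (rule integral_mono_AE)
    show "integrable lborel (\<lambda>t. ln (y / m) * (1 / ?k t) - ln_plus (y / \<bar>t\<bar>) / y\<^sup>2)"
      using k by (simp add: has_bochner_integral_iff)
    show "integrable lborel (\<lambda>t. ln_plus (\<bar>t\<bar> / m) / ?k t)"
      by (rule integrable_ln_plus_kernel[OF assms(1)])
    have "ln (y / m) * (1 / ?k t) - ln_plus (y / \<bar>t\<bar>) / y\<^sup>2 \<le> ln_plus (\<bar>t\<bar> / m) / ?k t"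
      if "t \<noteq> 0" for t
    proof -
      have "ln (y / m) \<le> ln_plus (\<bar>t\<bar> / m * (y / \<bar>t\<bar>))"
        using that assms ln_le_ln_plus[of "y / m"] by simp
      also have "\<dots> \<le> ln_plus (\<bar>t\<bar> / m) + ln_plus (y / \<bar>t\<bar>)"
        using that assms by (intro ln_plus_mult_le) auto
      finally have "ln (y / m) / ?k t \<le> ln_plus (\<bar>t\<bar> / m) / ?k t + ln_plus (y / \<bar>t\<bar>) / ?k t"
        unfolding add_divide_distrib[symmetric] by (intro divide_right_mono) auto
      moreover have "ln_plus (y / \<bar>t\<bar>) / ?k t \<le> ln_plus (y / \<bar>t\<bar>) / y\<^sup>2"
        using assms by (intro divide_left_mono) (auto simp: ln_plus_nonneg add_nonneg_pos)
      ultimately show ?thesis by simp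
    qed
    then show "AE t in lborel. ln (y / m) * (1 / ?k t) - ln_plus (y / \<bar>t\<bar>) / y\<^sup>2 \<le> ln_plus (\<bar>t\<bar> / m) / ?k t"
      by (intro AE_mp[OF AE_lborel_singleton[of "0::real"] AE_I2]) auto
  qed
  finally have "y / pi * (ln (y / m) * (pi / y) - 2 * y / y\<^sup>2) \<le> log_potential y m"
    unfolding log_potential_def using assms by (intro mult_left_mono) auto
  moreover have "y / pi * (ln (y / m) * (pi / y) - 2 * y / y\<^sup>2) = ln (y / m) - 2 / pi"
    using assms by (simp add: field_simps power2_eq_square)
  ultimately show ?thesis by simp
qed

section \<open>Condition \<open>gamma_one\<close> and exponents above 1\<close>

lemma inverse_powr_le_telescope:
  fixes \<delta> :: real
  assumes "0 < \<delta>"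
  defines "c \<equiv> (\<delta> / 2) / (1 + \<delta> / 2)"
  shows "c * (1 / real (q + 1) powr (1 + \<delta>))
    \<le> 1 / real (q + 1) powr \<delta> - 1 / real (Suc q + 1) powr \<delta>"
proof -
  \<comment> \<open>The difference to be bounded is (q + 1) powr (-\<delta>) times 1 - (1 + x) powr
    (-\<delta>). As ln (1 + x) \<ge> x / 2 for 0 < x \<le> 1, the last factor is at least
    (\<delta>/2) x / (1 + (\<delta>/2) x). Divided by x this decreases in x, and c is its value at x
    = 1.\<close>
  define x where "x = 1 / real (q + 1)"
  have x: "0 < x" "x \<le> 1" by (auto simp: x_def)
  have "(q + 2) / real (q + 1) = 1 + x" by (simp add: x_def field_simps)
  then have "real (Suc q + 1) = real (q + 1) * (1 + x)" by (simp add: field_simps)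
  then have split: "real (Suc q + 1) powr \<delta> = real (q + 1) powr \<delta> * (1 + x) powr \<delta>"
    using x by (simp only: powr_mult)
  have "x / 2 \<le> x / (1 + x)"
    using x by (intro divide_left_mono) auto
  also have "x / (1 + x) \<le> ln (1 + x)"
    using ln_le_minus_one[of "1 / (1 + x)"] x by (simp add: ln_div field_simps)
  finally have "\<delta> * (x / 2) \<le> \<delta> * ln (1 + x)"
    using assms(1) by (intro mult_left_mono) auto
  then have "1 + \<delta> / 2 * x \<le> 1 + \<delta> * ln (1 + x)" by simp
  also have "\<dots> \<le> (1 + x) powr \<delta>"
    using x exp_ge_add_one_self[of "\<delta> * ln (1 + x)"] by (simp add: powr_def)
  finally have "1 / (1 + x) powr \<delta> \<le> 1 / (1 + \<delta> / 2 * x)"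
    using x assms(1) by (intro divide_left_mono) (auto intro!: mult_pos_pos add_pos_nonneg)
  moreover have "1 - 1 / (1 + \<delta> / 2 * x) = \<delta> / 2 * x / (1 + \<delta> / 2 * x)"
    using x assms(1) by (simp add: field_simps add_nonneg_eq_0_iff)
  moreover have "c * x \<le> \<delta> / 2 * x / (1 + \<delta> / 2 * x)"
  proof -
    have "\<delta> / 2 * x \<le> \<delta> / 2" using x assms(1) by (simp add: mult_left_le)
    then have "\<delta> / 2 * x / (1 + \<delta> / 2) \<le> \<delta> / 2 * x / (1 + \<delta> / 2 * x)"
      using x assms(1) by (intro divide_left_mono) (auto intro!: mult_pos_pos add_pos_nonneg)
    then show ?thesis by (simp add: c_def)
  qed
  ultimately have "c * x \<le> 1 - 1 / (1 + x) powr \<delta>" by linarith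
  then have "c * x / real (q + 1) powr \<delta> \<le> (1 - 1 / (1 + x) powr \<delta>) / real (q + 1) powr \<delta>"
    by (intro divide_right_mono) auto
  then show ?thesis
    unfolding split powr_add by (simp add: x_def diff_divide_distrib mult.commute)
qed

lemma tail_sum_inverse_powr:
  fixes \<delta> :: real
  assumes "0 < \<delta>"
  obtains K where "0 < K"
    and "summable (\<lambda>q. 1 / real (q + 1) powr (1 + \<delta>))"
    and "\<And>p. (\<Sum>q. 1 / real (q + p + 1) powr (1 + \<delta>)) \<le> K / real (p + 1) powr \<delta>"
proof -
  define c where "c = (\<delta> / 2) / (1 + \<delta> / 2)"
  have c: "0 < c" using assms by (simp add: c_def add_pos_nonneg)
  let ?g = "\<lambda>q::nat. 1 / real (q + 1) powr \<delta>"
  have lim: "?g \<longlonglongrightarrow> 0" using assms by real_asymp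
  have g: "1 / real (q + 1) powr (1 + \<delta>) \<le> (?g q - ?g (Suc q)) / c" for q
    using inverse_powr_le_telescope[OF assms, of q] c unfolding c_def[symmetric]
    by (simp add: pos_le_divide_eq mult.commute)
  have tel: "(\<lambda>q. (?g (q + p) - ?g (Suc (q + p))) / c) sums (?g p / c)" for p
  proof -
    have "(\<lambda>q. ?g (q + p) - ?g (Suc q + p)) sums (?g (0 + p) - 0)"
      by (rule telescope_sums'[OF LIMSEQ_ignore_initial_segment[OF lim]])
    then have "(\<lambda>q. (?g (q + p) - ?g (Suc q + p)) / c) sums ((?g (0 + p) - 0) / c)"
      by (rule sums_divide)
    then show ?thesis by simp
  qed
  have sm: "summable (\<lambda>q. 1 / real (q + p + 1) powr (1 + \<delta>))" for p
  proof (rule summable_comparison_test)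
    show "summable (\<lambda>q. (?g (q + p) - ?g (Suc (q + p))) / c)"
      using tel by (rule sums_summable)
    show "\<exists>N. \<forall>q\<ge>N. norm (1 / real (q + p + 1) powr (1 + \<delta>)) \<le> (?g (q + p) - ?g (Suc (q + p))) / c"
      using g[of "_ + p"] by auto
  qed
  show thesis
  proof (rule that)
    show "0 < 1 / c" using c by simp
    show "summable (\<lambda>q. 1 / real (q + 1) powr (1 + \<delta>))"
      using sm[of 0] by simp
    show "(\<Sum>q. 1 / real (q + p + 1) powr (1 + \<delta>)) \<le> (1 / c) / real (p + 1) powr \<delta>" for p
    proof -
      have "(\<Sum>q. 1 / real (q + p + 1) powr (1 + \<delta>)) \<le> ?g p / c"
        using sums_le[OF g[of "_ + p"] summable_sums[OF sm[of p]] tel[of p]] .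
      also have "\<dots> = (1 / c) / real (p + 1) powr \<delta>"
        by (simp only: divide_divide_eq_left mult.commute)
      finally show ?thesis .
    qed
  qed
qed

text \<open>Petzsche's condition \<open>(\<gamma>\<^sub>1)\<close>.\<close>

definition gamma_one :: "(nat \<Rightarrow> real) \<Rightarrow> bool" where
  "gamma_one m \<longleftrightarrow> summable (\<lambda>q. 1 / m q) \<and>
     (\<exists>A>0. \<forall>p. (\<Sum>q. 1 / m (q + p)) \<le> A * real (p + 1) / m p)"

text \<open>Almost increase dominates 1 / m (q + p) by (p + 1) powr \<gamma> / m p times a power
  whose tail sum is of order (p + 1) powr (1 - \<gamma>). The powers combine to p + 1.\<close>

lemma gamma_one_if_almost_increasing:
  assumes pos: "\<And>p. 0 < m p" and "1 < \<gamma>"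
    and "almost_increasing (\<lambda>p. m p / real (p + 1) powr \<gamma>)"
  shows "gamma_one m"
proof -
  obtain a where a: "0 < a"
    "\<And>p q. p \<le> q \<Longrightarrow> m p / real (p + 1) powr \<gamma> \<le> a * (m q / real (q + 1) powr \<gamma>)"
    using assms(3) unfolding almost_increasing_def by blast
  define \<delta> where "\<delta> = \<gamma> - 1"
  have \<delta>: "0 < \<delta>" "\<gamma> = 1 + \<delta>" using assms(2) by (auto simp: \<delta>_def)
  obtain K where K: "0 < K" "summable (\<lambda>q. 1 / real (q + 1) powr \<gamma>)"
    "\<And>p. (\<Sum>q. 1 / real (q + p + 1) powr \<gamma>) \<le> K / real (p + 1) powr \<delta>"
    using tail_sum_inverse_powr[OF \<delta>(1)] unfolding \<delta>(2) by metis
  have le: "1 / m (q + p) \<le> a * real (p + 1) powr \<gamma> / m p * (1 / real (q + p + 1) powr \<gamma>)" for p q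
  proof -
    have "m p * real (q + p + 1) powr \<gamma> \<le> a * m (q + p) * real (p + 1) powr \<gamma>"
      using a(2)[of p "q + p"] by (simp add: field_simps)
    then show ?thesis using pos[of p] pos[of "q + p"] by (simp add: field_simps)
  qed
  have sK: "summable (\<lambda>q. 1 / real (q + p + 1) powr \<gamma>)" for p
    using K(2) by (subst summable_iff_shift)
  have sm: "summable (\<lambda>q. 1 / m q)"
    using le[of _ 0] pos
    by (intro summable_comparison_test[OF _ summable_mult[OF K(2), of "a / m 0"]])
       (auto simp: less_imp_le)
  have "(\<Sum>q. 1 / m (q + p)) \<le> a * K * real (p + 1) / m p" for p
  proof -
    have "(\<Sum>q. 1 / m (q + p)) \<le> (\<Sum>q. a * real (p + 1) powr \<gamma> / m p * (1 / real (q + p + 1) powr \<gamma>))"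
      using sm by (intro suminf_le le summable_mult sK) (subst summable_iff_shift)
    also have "\<dots> = a * real (p + 1) powr \<gamma> / m p * (\<Sum>q. 1 / real (q + p + 1) powr \<gamma>)"
      by (intro suminf_mult sK)
    also have "\<dots> \<le> a * real (p + 1) powr \<gamma> / m p * (K / real (p + 1) powr \<delta>)"
      using a(1) pos[of p] by (intro mult_left_mono K(3)) auto
    also have "\<dots> = a * K * real (p + 1) / m p"
      by (simp add: \<delta>(2) powr_add)
    finally show ?thesis .
  qed
  then show ?thesis
    unfolding gamma_one_def using sm a(1) K(1) by (intro conjI exI[of _ "a * K"]) auto
qed

text \<open>Let S p be the tail sum. The condition bounds its decrement 1 / m p below by \<delta> S
  p / (p + 1) with \<delta> = 1 / A, so S p (p + 1) powr \<delta> decreases. Monotonicity of m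
  bounds S (q div 2) below by (q + 1) / (2 m q). Comparing both with S p \<le> A (p + 1) / m p
  yields the exponent 1 + \<delta>.\<close>

lemma almost_increasing_if_gamma_one:
  assumes pos: "\<And>p. 0 < m p" and mono: "\<And>p q. p \<le> q \<Longrightarrow> m p \<le> m q"
    and "gamma_one m"
  shows "\<exists>\<gamma>>1. almost_increasing (\<lambda>p. m p / real (p + 1) powr \<gamma>)"
proof -
  obtain A where A: "0 < A" "\<And>p. (\<Sum>q. 1 / m (q + p)) \<le> A * real (p + 1) / m p"
    and sm: "summable (\<lambda>q. 1 / m q)"
    using assms(3) unfolding gamma_one_def by blast
  define S where "S p = (\<Sum>q. 1 / m (q + p))" for p
  define \<delta> where "\<delta> = 1 / A"
  have \<delta>: "0 < \<delta>" using A(1) by (simp add: \<delta>_def)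
  have smp: "summable (\<lambda>q. 1 / m (q + p))" for p
    using sm by (subst summable_iff_shift)
  have S_nonneg: "0 \<le> S p" for p
    unfolding S_def using pos by (intro suminf_nonneg smp) (auto simp: less_imp_le)
  have step: "S (Suc p) * real (Suc p + 1) powr \<delta> \<le> S p * real (p + 1) powr \<delta>" for p
  proof -
    have "S p = S (Suc p) + 1 / m p"
      using suminf_split_head[OF smp[of p]] by (simp add: S_def)
    moreover have "\<delta> / real (p + 1) * S p \<le> 1 / m p"
    proof -
      have "\<delta> / real (p + 1) * S p \<le> \<delta> / real (p + 1) * (A * real (p + 1) / m p)"
        using \<delta> A(2)[of p] by (intro mult_left_mono) (auto simp: S_def)
      also have "\<dots> = 1 / m p"
        using A(1) by (simp add: \<delta>_def del: of_nat_add)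
      finally show ?thesis .
    qed
    ultimately have "S (Suc p) \<le> S p * (1 - \<delta> / real (p + 1))"
      by (simp add: algebra_simps)
    also have "\<dots> \<le> S p * exp (- (\<delta> / real (p + 1)))"
      using exp_ge_add_one_self[of "- (\<delta> / real (p + 1))"] by (intro mult_left_mono S_nonneg) auto
    finally have "S (Suc p) * real (Suc p + 1) powr \<delta>
        \<le> S p * exp (- (\<delta> / real (p + 1))) * real (Suc p + 1) powr \<delta>"
      by (intro mult_right_mono) auto
    \<comment> \<open>The quotient (p + 2) / (p + 1) is at most exp (1 / (p + 1)), so the
      exponential factor pays for the growth of the power.\<close>
    also have "\<dots> \<le> S p * real (p + 1) powr \<delta>"
    proof -
      have "ln (real (Suc p + 1) / real (p + 1)) \<le> 1 / real (p + 1)"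
        using ln_le_minus_one[of "real (Suc p + 1) / real (p + 1)"] by (simp add: field_simps)
      then have "ln (real (Suc p + 1)) \<le> ln (real (p + 1)) + 1 / real (p + 1)"
        by (subst (asm) ln_div) auto
      then have "\<delta> * ln (real (Suc p + 1)) \<le> \<delta> * (ln (real (p + 1)) + 1 / real (p + 1))"
        using \<delta> by (intro mult_left_mono) auto
      then have "exp (- (\<delta> / real (p + 1))) * real (Suc p + 1) powr \<delta> \<le> real (p + 1) powr \<delta>"
        by (simp add: powr_def exp_add[symmetric] algebra_simps)
      then show ?thesis
        using mult_left_mono[OF _ S_nonneg[of p]] by (simp add: mult.assoc)
    qed
    finally show ?thesis .
  qed
  have decr: "S r * real (r + 1) powr \<delta> \<le> S p * real (p + 1) powr \<delta>" if "p \<le> r" for p r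
    using that by (rule lift_Suc_antimono_le[of "\<lambda>p. S p * real (p + 1) powr \<delta>", OF step])
  \<comment> \<open>A + 1 serves both cases: it is at least 1, as needed when q + 1 \<le> 2 (p + 1)
    and monotonicity suffices, and at least A, as needed otherwise.\<close>
  let ?a = "(A + 1) * 2 powr (1 + \<delta>)"
  have "m p * real (q + 1) powr (1 + \<delta>) \<le> ?a * m q * real (p + 1) powr (1 + \<delta>)" if "p \<le> q" for p q
  proof (cases "q + 1 \<le> 2 * (p + 1)")
    case True
    then have "real (q + 1) powr (1 + \<delta>) \<le> (2 * real (p + 1)) powr (1 + \<delta>)"
      using \<delta> by (intro powr_mono2) (auto simp flip: of_nat_le_iff)
    also have "\<dots> = 2 powr (1 + \<delta>) * real (p + 1) powr (1 + \<delta>)"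
      by (simp only: powr_mult)
    finally have "m p * real (q + 1) powr (1 + \<delta>) \<le> m q * (2 powr (1 + \<delta>) * real (p + 1) powr (1 + \<delta>))"
      using mono[OF that] pos[of q] by (intro mult_mono) (auto simp: less_imp_le)
    also have "\<dots> \<le> (A + 1) * (m q * (2 powr (1 + \<delta>) * real (p + 1) powr (1 + \<delta>)))"
      using A(1) pos[of q] mult_right_mono[of 1 "A + 1" "m q * (2 powr (1 + \<delta>) * real (p + 1) powr (1 + \<delta>))"]
      by simp
    finally show ?thesis by (simp add: mult_ac)
  next
    case False
    \<comment> \<open>The midpoint satisfies p \<le> r in this case. Both r + 1 and the number of
      indices from r to q are at least (q + 1) / 2.\<close>
    define r where "r = q div 2"
    have r: "p \<le> r" "r \<le> q" using False that by (auto simp: r_def)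
    have r1: "real (q + 1) / 2 \<le> real (r + 1)" "real (q + 1) / 2 \<le> real (Suc q - r)"
    proof -
      have "q + 1 \<le> 2 * (r + 1)"
        unfolding r_def by presburger
      moreover have "q + 1 \<le> 2 * (Suc q - r)"
        unfolding r_def by presburger
      ultimately have "real (q + 1) \<le> real (2 * (r + 1))" "real (q + 1) \<le> real (2 * (Suc q - r))"
        by (simp_all only: of_nat_le_iff)
      then show "real (q + 1) / 2 \<le> real (r + 1)" "real (q + 1) / 2 \<le> real (Suc q - r)"
        by simp_all
    qed
    have "real (q + 1) / 2 * (1 / m q) \<le> real (Suc q - r) * (1 / m q)"
      using r1(2) pos[of q] by (intro mult_right_mono) (auto simp: less_imp_le)
    also have "\<dots> = (\<Sum>j<Suc q - r. 1 / m q)" by simp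
    also have "\<dots> \<le> (\<Sum>j<Suc q - r. 1 / m (j + r))"
      using pos r by (intro sum_mono divide_left_mono mono mult_pos_pos) auto
    also have "\<dots> \<le> S r"
      unfolding S_def using pos by (intro sum_le_suminf smp) (auto simp: less_imp_le)
    finally have "real (q + 1) / 2 * (1 / m q) * (real (q + 1) / 2) powr \<delta> \<le> S r * real (r + 1) powr \<delta>"
      using r1(1) \<delta> S_nonneg by (intro mult_mono powr_mono2) auto
    also have "\<dots> \<le> S p * real (p + 1) powr \<delta>" by (rule decr[OF r(1)])
    also have "\<dots> \<le> A * real (p + 1) / m p * real (p + 1) powr \<delta>"
      unfolding S_def by (intro mult_right_mono A(2)) auto
    finally have "(real (q + 1) / 2) powr (1 + \<delta>) / m q \<le> A * real (p + 1) powr (1 + \<delta>) / m p"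
      by (simp add: powr_add mult_ac)
    then have "m p * (real (q + 1) / 2) powr (1 + \<delta>) \<le> A * m q * real (p + 1) powr (1 + \<delta>)"
      using pos[of p] pos[of q] by (simp add: field_simps)
    then have "2 powr (1 + \<delta>) * (m p * (real (q + 1) / 2) powr (1 + \<delta>))
        \<le> 2 powr (1 + \<delta>) * (A * m q * real (p + 1) powr (1 + \<delta>))"
      by (rule mult_left_mono) simp
    moreover have "2 powr (1 + \<delta>) * (real (q + 1) / 2) powr (1 + \<delta>) = real (q + 1) powr (1 + \<delta>)"
    proof -
      have "2 * (real (q + 1) / 2) = real (q + 1)" by simp
      then show ?thesis by (simp only: powr_mult[symmetric])
    qed
    ultimately have "m p * real (q + 1) powr (1 + \<delta>) \<le> 2 powr (1 + \<delta>) * (A * m q * real (p + 1) powr (1 + \<delta>))"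
      by (simp only: mult.left_commute)
    also have "\<dots> \<le> 2 powr (1 + \<delta>) * ((A + 1) * m q * real (p + 1) powr (1 + \<delta>))"
      using pos[of q] by (intro mult_left_mono mult_right_mono) (auto simp: less_imp_le)
    finally show ?thesis by (simp add: mult_ac)
  qed
  then have "m p / real (p + 1) powr (1 + \<delta>) \<le> ?a * (m q / real (q + 1) powr (1 + \<delta>))" if "p \<le> q" for p q
    using that by (simp add: field_simps)
  then have "almost_increasing (\<lambda>p. m p / real (p + 1) powr (1 + \<delta>))"
    unfolding almost_increasing_def using A(1) by (intro exI[of _ ?a]) auto
  then show ?thesis using \<delta> by (intro exI[of _ "1 + \<delta>"]) auto
qed

section \<open>The associated function of a weight sequence as a series over the quotients\<close>

lemma weight_sequence_pos: "weight_sequence M \<Longrightarrow> 0 < M p"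
  by (simp add: weight_sequence_def)

lemma quot_seq_pos: "weight_sequence M \<Longrightarrow> 0 < quot_seq M p"
  by (simp add: quot_seq_def weight_sequence_pos)

lemma quot_seq_mono:
  assumes "weight_sequence M" "p \<le> q"
  shows "quot_seq M p \<le> quot_seq M q"
proof (rule lift_Suc_mono_le[OF _ assms(2)])
  fix n
  have "(M (Suc n))\<^sup>2 \<le> M n * M (Suc (Suc n))"
    using assms(1) unfolding weight_sequence_def by (metis Suc_eq_plus1 add_diff_cancel_right' le_add2)
  then show "quot_seq M n \<le> quot_seq M (Suc n)"
    using weight_sequence_pos[OF assms(1), of n] weight_sequence_pos[OF assms(1), of "Suc n"]
    by (simp add: quot_seq_def field_simps power2_eq_square)
qed

lemma weight_sequence_eq_prod:
  assumes "weight_sequence M"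
  shows "M p = (\<Prod>q<p. quot_seq M q)"
proof (induction p)
  case 0
  then show ?case using assms by (simp add: weight_sequence_def)
next
  case (Suc p)
  have "M (Suc p) = M p * quot_seq M p"
    using weight_sequence_pos[OF assms, of p] by (simp add: quot_seq_def)
  then show ?case by (simp only: Suc.IH prod.lessThan_Suc)
qed

lemma quot_seq_cutoff:
  assumes "weight_sequence M"
  obtains n where "\<And>q. q < n \<Longrightarrow> quot_seq M q \<le> t" "\<And>q. n \<le> q \<Longrightarrow> t < quot_seq M q"
proof -
  have "eventually (\<lambda>q. t < quot_seq M q) sequentially"
    using assms by (simp add: weight_sequence_def filterlim_at_top_dense)
  then obtain n where "t < quot_seq M n"
    by (auto simp: eventually_sequentially)
  then obtain n where n: "t < quot_seq M n" "\<forall>k<n. \<not> t < quot_seq M k"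
    using exists_least_iff[of "\<lambda>n. t < quot_seq M n"] by blast
  show thesis
  proof (rule that)
    show "quot_seq M q \<le> t" if "q < n" for q
      using n(2) that by (simp add: not_less)
    show "t < quot_seq M q" if "n \<le> q" for q
      using n(1) quot_seq_mono[OF assms that] by (rule less_le_trans)
  qed
qed

text \<open>ln (t^p / M p) is the sum of the first p terms ln (t / m q). These decrease in q, so the
  sum is maximal when p = n counts the m q \<le> t, which are exactly the nonnegative terms. Later
  terms of the series vanish.\<close>

lemma ln_plus_sums_omega:
  assumes M: "weight_sequence M" and "0 \<le> t"
  shows "(\<lambda>q. ln_plus (t / quot_seq M q)) sums omega M t"
proof (cases "t = 0")
  case True
  then show ?thesis by (simp add: omega_def ln_plus_eq_0)
next
  case False
  with assms have t: "0 < t" by simp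
  obtain n where n: "\<And>q. q < n \<Longrightarrow> quot_seq M q \<le> t" "\<And>q. n \<le> q \<Longrightarrow> t < quot_seq M q"
    using quot_seq_cutoff[OF M, of t] by blast
  let ?l = "\<lambda>q. ln (t / quot_seq M q)" and ?lp = "\<lambda>q. ln_plus (t / quot_seq M q)"
  have zero: "?lp q = 0" if "n \<le> q" for q
    using n(2)[OF that] t by (intro ln_plus_eq_0) auto
  have expand: "ln (t ^ p / M p) = (\<Sum>q<p. ?l q)" for p
  proof -
    have "ln (t ^ p / M p) = ln (\<Prod>q<p. t / quot_seq M q)"
      by (simp add: weight_sequence_eq_prod[OF M, of p] prod_dividef)
    also have "\<dots> = (\<Sum>q<p. ?l q)"
      using t less_imp_neq[OF quot_seq_pos[OF M]] by (intro ln_prod) auto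
    finally show ?thesis .
  qed
  have "(\<Sum>q<p. ?l q) \<le> (\<Sum>q<n. ?lp q)" for p
  proof -
    have "(\<Sum>q<p. ?l q) \<le> (\<Sum>q<p. ?lp q)"
      by (intro sum_mono ln_le_ln_plus)
    also have "\<dots> \<le> (\<Sum>q<max p n. ?lp q)"
      by (intro sum_mono2) (auto simp: ln_plus_nonneg)
    also have "\<dots> = (\<Sum>q<n. ?lp q)"
      by (intro sum.mono_neutral_right) (auto simp: zero)
    finally show ?thesis .
  qed
  moreover have "(\<Sum>q<n. ?lp q) = (\<Sum>q<n. ?l q)"
    using n(1) quot_seq_pos[OF M] by (intro sum.cong ln_plus_eq_ln) auto
  ultimately have "(SUP p. ln (t ^ p / M p)) = (\<Sum>q<n. ?lp q)"
    unfolding expand by (intro cSup_eq_maximum) auto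
  then have "omega M t = (\<Sum>q<n. ?lp q)"
    using t by (simp add: omega_def)
  then show ?thesis
    using sums_finite[of "{..<n}" ?lp] zero by simp
qed

text \<open>Here n need not be the cutoff belonging to t. This allows omega at a dilated argument to
  be estimated with the cutoff of the original one.\<close>

lemma sum_ln_le_omega:
  assumes M: "weight_sequence M" and "0 \<le> t"
  shows "(\<Sum>q<n. ln (t / quot_seq M q)) \<le> omega M t"
proof -
  have "(\<Sum>q<n. ln (t / quot_seq M q)) \<le> (\<Sum>q<n. ln_plus (t / quot_seq M q))"
    by (intro sum_mono ln_le_ln_plus)
  also have "\<dots> \<le> (\<Sum>q. ln_plus (t / quot_seq M q))"
    using ln_plus_sums_omega[OF assms] by (intro sum_le_suminf) (auto simp: ln_plus_nonneg sums_iff)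
  also have "\<dots> = omega M t"
    using ln_plus_sums_omega[OF assms] by (simp add: sums_iff)
  finally show ?thesis .
qed

lemma nq_check_seq_iff:
  assumes "weight_sequence M"
  shows "nq (check_seq M) \<longleftrightarrow> summable (\<lambda>q. 1 / quot_seq M q)"
proof -
  have "check_seq M p / (real (p + 1) * check_seq M (p + 1)) = 1 / quot_seq M p" for p
  proof -
    have "real (p + 1) * check_seq M (p + 1) = M (p + 1) / fact p"
      by (simp add: check_seq_def del: of_nat_Suc)
    then show ?thesis by (simp add: check_seq_def quot_seq_def)
  qed
  then show ?thesis by (simp only: nq_def)
qed

text \<open>The series for omega is integrated term by term. The integrals of the nonnegative terms
  are at most 2 / m q by \<open>log_potential_le\<close>, so summability of 1 / m q justifies the
  interchange.\<close>

lemma log_potential_sums_harmonic_extension: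
  assumes M: "weight_sequence M" and sm: "summable (\<lambda>q. 1 / quot_seq M q)" and y: "0 < y"
  shows "(\<lambda>q. log_potential y (quot_seq M q)) sums harmonic_extension M (\<i> * of_real y)"
proof -
  let ?f = "\<lambda>q t. ln_plus (\<bar>t\<bar> / quot_seq M q) / (t\<^sup>2 + y\<^sup>2)"
  note pos = quot_seq_pos[OF M] and lp = ln_plus_sums_omega[OF M abs_ge_zero]
  have "(\<lambda>q. LINT t|lborel. ?f q t) sums (LINT t|lborel. (\<Sum>q. ?f q t))"
  proof (rule sums_integral)
    show "integrable lborel (?f q)" for q
      by (rule integrable_ln_plus_kernel[OF pos])
    show "AE t in lborel. summable (\<lambda>q. norm (?f q t))"
      using lp by (auto simp: ln_plus_nonneg intro!: AE_I2 summable_divide sums_summable)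
    have "norm (LINT t|lborel. norm (?f q t)) \<le> 2 * (1 / quot_seq M q)" for q
    proof -
      have "(LINT t|lborel. ?f q t) = pi / y * log_potential y (quot_seq M q)"
        using y by (simp add: log_potential_def)
      also have "\<dots> \<le> pi / y * (2 * y / (pi * quot_seq M q))"
        using y by (intro mult_left_mono log_potential_le pos) auto
      also have "\<dots> = 2 * (1 / quot_seq M q)"
        using y by simp
      finally show ?thesis
        by (simp add: ln_plus_nonneg)
    qed
    then show "summable (\<lambda>q. LINT t|lborel. norm (?f q t))"
      by (intro summable_comparison_test[OF _ summable_mult[OF sm, of 2]]) auto
  qed
  then have "(\<lambda>q. y / pi * (LINT t|lborel. ?f q t)) sums (y / pi * (LINT t|lborel. (\<Sum>q. ?f q t)))"
    by (rule sums_mult)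
  moreover have "(\<Sum>q. ?f q t) = omega M \<bar>t\<bar> / (t\<^sup>2 + y\<^sup>2)" for t
    using sums_divide[OF lp] by (rule sums_unique[symmetric])
  ultimately show ?thesis
    using y by (simp add: log_potential_def harmonic_extension_def)
qed

section \<open>Langenbruch's condition and \<open>gamma_one\<close>\<close>

lemma langenbruch_if_gamma_one:
  assumes M: "weight_sequence M" and "gamma_one (quot_seq M)"
  shows "langenbruch M"
proof -
  let ?m = "quot_seq M"
  obtain A where A: "0 < A" "\<And>p. (\<Sum>q. 1 / ?m (q + p)) \<le> A * real (p + 1) / ?m p"
    and sm: "summable (\<lambda>q. 1 / ?m q)"
    using assms(2) unfolding gamma_one_def by blast
  note pos = quot_seq_pos[OF M]
  \<comment> \<open>Let p count the m q \<le> y. The first p terms exceed their logarithms by at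
    most 2 / pi each, and the tail is at most (2 / pi) A (p + 1). Dilating y by exp K raises each of
    the p logarithms by K, which pays for all of this except (2 / pi) A; the additive constant
    covers that.\<close>
  define K where "K = 2 / pi + 2 / pi * A"
  have K: "0 < K" using A(1) by (simp add: K_def add_pos_pos)
  have "harmonic_extension M (\<i> * of_real y) \<le> omega M (exp K * y) + exp K" if "0 < y" for y
  proof -
    obtain p where p: "\<And>q. q < p \<Longrightarrow> ?m q \<le> y" "\<And>q. p \<le> q \<Longrightarrow> y < ?m q"
      using quot_seq_cutoff[OF M, of y] by blast
    note L = log_potential_sums_harmonic_extension[OF M sm that]
    have smp: "summable (\<lambda>q. 1 / ?m (q + p))"
      using sm by (subst summable_iff_shift)
    have smL: "summable (\<lambda>q. log_potential y (?m (q + p)))"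
      using sums_summable[OF L] by (subst summable_iff_shift)
    have "harmonic_extension M (\<i> * of_real y)
        = (\<Sum>q. log_potential y (?m (q + p))) + (\<Sum>q<p. log_potential y (?m q))"
      using suminf_split_initial_segment[OF sums_summable[OF L], of p] sums_unique[OF L] by simp
    also have "(\<Sum>q. log_potential y (?m (q + p))) \<le> (\<Sum>q. 2 / pi * y * (1 / ?m (q + p)))"
      using log_potential_le[OF pos that] by (intro suminf_le summable_mult smp smL) simp
    also have "\<dots> = 2 / pi * y * (\<Sum>q. 1 / ?m (q + p))"
      by (rule suminf_mult[OF smp])
    also have "\<dots> \<le> 2 / pi * y * (A * real (p + 1) / ?m p)"
      using that by (intro mult_left_mono A(2)) auto
    also have "\<dots> = 2 / pi * A * real (p + 1) * (y / ?m p)"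
      by simp
    also have "\<dots> \<le> 2 / pi * A * real (p + 1) * 1"
      using A(1) p(2)[of p] pos[of p] by (intro mult_left_mono) auto
    also have "(\<Sum>q<p. log_potential y (?m q)) \<le> (\<Sum>q<p. ln (y / ?m q) + 2 / pi)"
    proof (intro sum_mono)
      fix q assume "q \<in> {..<p}"
      then have "ln_plus (y / ?m q) = ln (y / ?m q)"
        using p(1)[of q] pos[of q] by (intro ln_plus_eq_ln) auto
      then show "log_potential y (?m q) \<le> ln (y / ?m q) + 2 / pi"
        using log_potential_le_ln_plus[OF pos[of q] that] by simp
    qed
    also have "(\<Sum>q<p. ln (y / ?m q) + 2 / pi) = (\<Sum>q<p. ln (exp K * y / ?m q)) + real p * (2 / pi - K)"
    proof -
      have "ln (exp K * y / ?m q) = K + ln (y / ?m q)" for q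
        using that pos[of q] by (simp add: ln_mult ln_div)
      then show ?thesis by (simp add: sum.distrib algebra_simps)
    qed
    also have "(\<Sum>q<p. ln (exp K * y / ?m q)) \<le> omega M (exp K * y)"
      using that by (intro sum_ln_le_omega[OF M]) simp
    finally have "harmonic_extension M (\<i> * of_real y)
        \<le> 2 / pi * A * real (p + 1) * 1 + (omega M (exp K * y) + real p * (2 / pi - K))"
      by simp
    also have "\<dots> = omega M (exp K * y) + 2 / pi * A"
      by (simp add: K_def algebra_simps add_divide_distrib)
    also have "2 / pi * A \<le> exp K"
    proof -
      have "2 / pi * A \<le> K" by (simp add: K_def)
      then show ?thesis using exp_ge_add_one_self[of K] by linarith
    qed
    finally show ?thesis by simp
  qed
  \<comment> \<open>At y = 0 the extension is defined by its boundary value omega M 0 = 0.\<close>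
  moreover have "harmonic_extension M (\<i> * of_real 0) \<le> omega M (exp K * 0) + exp K"
    by (simp add: harmonic_extension_def omega_def)
  ultimately show ?thesis
    unfolding langenbruch_def by (intro exI[of _ "exp K"]) (auto simp: le_less)
qed

text \<open>Test the condition at y = m p. The logarithms ln (y / m q) with q < p occur on both
  sides and cancel, leaving y / pi times the tail sum on the left. On the right remain C and at most
  \<open>ln_plus C\<close> for each index below a bound linear in p + 1.\<close>

lemma gamma_one_if_langenbruch:
  assumes M: "weight_sequence M" and sm: "summable (\<lambda>q. 1 / quot_seq M q)"
    and "langenbruch M" and "0 < \<gamma>"
    and "almost_increasing (\<lambda>p. quot_seq M p / real (p + 1) powr \<gamma>)"
  shows "gamma_one (quot_seq M)"
proof -
  let ?m = "quot_seq M"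
  note pos = quot_seq_pos[OF M]
  obtain a where a: "0 < a"
    "\<And>p q. p \<le> q \<Longrightarrow> ?m p / real (p + 1) powr \<gamma> \<le> a * (?m q / real (q + 1) powr \<gamma>)"
    using assms(5) unfolding almost_increasing_def by blast
  obtain C where C: "0 < C"
    "\<And>y. 0 \<le> y \<Longrightarrow> harmonic_extension M (\<i> * of_real y) \<le> omega M (C * y) + C"
    using assms(3) unfolding langenbruch_def by blast
  \<comment> \<open>If m q < C m p with p \<le> q, almost increase gives (q + 1) powr \<gamma> \<le>
    a C (p + 1) powr \<gamma>. Taking the root of order \<gamma> produces B; this is where \<gamma>
    > 0 enters.\<close>
  define B where "B = (a * C) powr (1 / \<gamma>)"
  have B: "0 \<le> B" by (simp add: B_def)
  have small: "real (q + 1) \<le> B * real (p + 1)" if "p \<le> q" "?m q < C * ?m p" for p q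
  proof -
    have "?m p * real (q + 1) powr \<gamma> \<le> a * ?m q * real (p + 1) powr \<gamma>"
      using a(2)[OF that(1)] by (simp add: field_simps)
    also have "\<dots> \<le> a * (C * ?m p) * real (p + 1) powr \<gamma>"
      using that(2) a(1) by (intro mult_right_mono mult_left_mono) auto
    finally have "?m p * real (q + 1) powr \<gamma> \<le> ?m p * (a * C * real (p + 1) powr \<gamma>)"
      by (simp only: mult_ac)
    then have "real (q + 1) powr \<gamma> \<le> a * C * real (p + 1) powr \<gamma>"
      using pos[of p] by (simp only: mult_le_cancel_left_pos)
    then have "(real (q + 1) powr \<gamma>) powr (1 / \<gamma>) \<le> (a * C * real (p + 1) powr \<gamma>) powr (1 / \<gamma>)"
      using assms(4) by (intro powr_mono2) auto
    then show ?thesis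
      using assms(4) a(1) C(1) by (simp add: B_def powr_mult powr_powr)
  qed
  define c where "c = ln_plus C"
  have c: "0 \<le> c" by (simp add: c_def ln_plus_nonneg)
  define A where "A = pi * (2 / pi + c * (B + 1) + C)"
  have "(\<Sum>q. 1 / ?m (q + p)) \<le> A * real (p + 1) / ?m p" for p
  proof -
    define y where "y = ?m p"
    have y: "0 < y" by (simp add: y_def pos)
    note L = log_potential_sums_harmonic_extension[OF M sm y]
    have smp: "summable (\<lambda>q. 1 / ?m (q + p))"
      using sm by (subst summable_iff_shift)
    have smL: "summable (\<lambda>q. log_potential y (?m (q + p)))"
      using sums_summable[OF L] by (subst summable_iff_shift)
    have ge: "y \<le> ?m q" if "p \<le> q" for q
      unfolding y_def by (rule quot_seq_mono[OF M that])
    have "y / pi * (\<Sum>q. 1 / ?m (q + p)) = (\<Sum>q. y / pi * (1 / ?m (q + p)))"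
      by (rule suminf_mult[OF smp, symmetric])
    also have "\<dots> \<le> (\<Sum>q. log_potential y (?m (q + p)))"
      using log_potential_ge_divide[OF y ge] by (intro suminf_le summable_mult smp smL) simp
    finally have "y / pi * (\<Sum>q. 1 / ?m (q + p)) + (\<Sum>q<p. ln (y / ?m q) - 2 / pi)
        \<le> (\<Sum>q. log_potential y (?m (q + p))) + (\<Sum>q<p. log_potential y (?m q))"
      using log_potential_ge_ln[OF pos y] by (intro add_mono sum_mono)
    also have "\<dots> = harmonic_extension M (\<i> * of_real y)"
      using suminf_split_initial_segment[OF sums_summable[OF L], of p] sums_unique[OF L] by simp
    also have "\<dots> \<le> omega M (C * y) + C"
      using y by (intro C(2)) simp
    also have "omega M (C * y) \<le> c * ((B + 1) * real (p + 1)) + (\<Sum>q<p. ln (y / ?m q))"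
    proof -
      \<comment> \<open>From N on, m q \<ge> C y by \<open>small\<close>, so the series for omega at
        C y stops there. The maximum with p keeps all indices q < p in the range.\<close>
      define N where "N = max p (nat \<lfloor>B * real (p + 1)\<rfloor>)"
      have N: "real N \<le> (B + 1) * real (p + 1)"
      proof -
        have "0 \<le> B * real (p + 1)" using B by simp
        then have "real (nat \<lfloor>B * real (p + 1)\<rfloor>) \<le> B * real (p + 1)"
          by (simp only: of_nat_floor)
        moreover have "real N \<le> real (p + nat \<lfloor>B * real (p + 1)\<rfloor>)"
          unfolding of_nat_le_iff by (simp add: N_def)
        ultimately have "real N \<le> real p + B * real (p + 1)"
          unfolding of_nat_add by linarith
        also have "\<dots> \<le> (B + 1) * real (p + 1)"
          by (simp add: algebra_simps)
        finally show ?thesis .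
      qed
      have zero: "ln_plus (C * y / ?m q) = 0" if "N \<le> q" for q
      proof -
        have "p \<le> q" using that by (simp add: N_def)
        moreover have "nat \<lfloor>B * real (p + 1)\<rfloor> \<le> q" using that by (simp add: N_def)
        then have "B * real (p + 1) < real (q + 1)" by linarith
        ultimately have "C * y \<le> ?m q"
          using small[of p q] unfolding y_def by linarith
        then show ?thesis using pos[of q] y C(1) by (intro ln_plus_eq_0) auto
      qed
      have "omega M (C * y) = (\<Sum>q<N. ln_plus (C * y / ?m q))"
        using ln_plus_sums_omega[OF M, of "C * y"] C(1) y zero
          sums_finite[of "{..<N}" "\<lambda>q. ln_plus (C * y / ?m q)"]
        by (auto intro: sums_unique2)
      also have "\<dots> \<le> (\<Sum>q<N. c + ln_plus (y / ?m q))"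
        using ln_plus_mult_le[of C "y / ?m _"] C(1) y pos
        by (intro sum_mono) (auto simp: c_def)
      also have "\<dots> = c * real N + (\<Sum>q<N. ln_plus (y / ?m q))"
        by (simp add: sum.distrib)
      \<comment> \<open>For p \<le> q the quotient y / m q is at most 1, since y = m p and m
        increases.\<close>
      also have "(\<Sum>q<N. ln_plus (y / ?m q)) = (\<Sum>q<p. ln_plus (y / ?m q))"
      proof (intro sum.mono_neutral_right ballI)
        fix q assume "q \<in> {..<N} - {..<p}"
        then show "ln_plus (y / ?m q) = 0"
          using ge[of q] pos[of q] y by (intro ln_plus_eq_0) auto
      qed (auto simp: N_def)
      also have "\<dots> = (\<Sum>q<p. ln (y / ?m q))"
        using quot_seq_mono[OF M] pos
        by (intro sum.cong ln_plus_eq_ln) (auto simp: y_def)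
      also have "c * real N \<le> c * ((B + 1) * real (p + 1))"
        by (rule mult_left_mono[OF N c])
      finally show ?thesis by simp
    qed
    finally have "y / pi * (\<Sum>q. 1 / ?m (q + p))
        \<le> real p * (2 / pi) + c * ((B + 1) * real (p + 1)) + C"
      by (simp add: sum_subtractf)
    also have "\<dots> \<le> real (p + 1) * (2 / pi) + c * ((B + 1) * real (p + 1)) + C * real (p + 1)"
    proof -
      have "real p * (2 / pi) \<le> real (p + 1) * (2 / pi)"
        by (intro mult_right_mono) auto
      moreover have "C \<le> C * real (p + 1)"
        using C(1) by simp
      ultimately show ?thesis by linarith
    qed
    also have "\<dots> = (2 / pi + c * (B + 1) + C) * real (p + 1)"
      by (simp only: algebra_simps)
    finally have "pi / y * (y / pi * (\<Sum>q. 1 / ?m (q + p)))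
        \<le> pi / y * ((2 / pi + c * (B + 1) + C) * real (p + 1))"
      using y by (intro mult_left_mono) auto
    moreover have "pi / y * (y / pi * (\<Sum>q. 1 / ?m (q + p))) = (\<Sum>q. 1 / ?m (q + p))"
      using y by simp
    moreover have "pi / y * ((2 / pi + c * (B + 1) + C) * real (p + 1)) = A * real (p + 1) / ?m p"
      unfolding A_def y_def by (simp only: times_divide_eq_left mult.assoc)
    ultimately show ?thesis by simp
  qed
  moreover have "0 < A"
    using c B C(1) by (simp add: A_def add_nonneg_pos add_pos_nonneg)
  ultimately show ?thesis
    unfolding gamma_one_def using sm by blast
qed

section \<open>From single exponents to the supremum \<open>gamma_index\<close> and back\<close>

theorem proposition3p6:
  fixes M :: "nat \<Rightarrow> real"
  assumes "weight_sequence M"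
  shows "(gamma_index M > 0 \<and> nq (check_seq M) \<and> langenbruch M) \<longleftrightarrow> gamma_index M > 1"
proof
  let ?S = "\<lambda>\<gamma>. almost_increasing (\<lambda>p. quot_seq M p / real (p + 1) powr \<gamma>)"
  note pos = quot_seq_pos[OF assms] and mono = quot_seq_mono[OF assms]
  {
    assume *: "gamma_index M > 0 \<and> nq (check_seq M) \<and> langenbruch M"
    \<comment> \<open>A supremum strictly above a bound has a member of the set strictly above it,
      so one admissible exponent is at hand.\<close>
    then obtain \<gamma> where "0 < \<gamma>" "?S \<gamma>"
      by (auto simp: gamma_index_def less_Sup_iff)
    with * have "gamma_one (quot_seq M)"
      using gamma_one_if_langenbruch[OF assms] nq_check_seq_iff[OF assms] by blast
    then obtain \<gamma>' where \<gamma>': "1 < \<gamma>'" "?S \<gamma>'"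
      using almost_increasing_if_gamma_one[of "quot_seq M", OF pos mono] by blast
    then have "1 < ennreal \<gamma>'" by simp
    also have "ennreal \<gamma>' \<le> gamma_index M"
      unfolding gamma_index_def using \<gamma>' by (intro Sup_upper) auto
    finally show "gamma_index M > 1" .
  next
    assume *: "gamma_index M > 1"
    then obtain \<gamma> where \<gamma>: "1 < ennreal \<gamma>" "?S \<gamma>"
      by (auto simp: gamma_index_def less_Sup_iff)
    then have "gamma_one (quot_seq M)"
      by (intro gamma_one_if_almost_increasing[OF pos]) auto
    moreover from this have "nq (check_seq M)"
      by (simp add: nq_check_seq_iff[OF assms] gamma_one_def)
    moreover have "0 < gamma_index M"
      using * by (rule less_trans[OF zero_less_one])
    ultimately show "gamma_index M > 0 \<and> nq (check_seq M) \<and> langenbruch M"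
      using langenbruch_if_gamma_one[OF assms] by blast
  }
qed

end
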